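(* Let $R=\mathbb{R}$ or $\mathbb{C}$ and $t\in\Omega_R=R\setminus\mathbb{Z}_{\ge0}$. For a sequence $f_m\in\mathcal{U}(HR)$ and $f\in\mathcal{U}(HR)$, the following are equivalent: (i) $f_m(n)\to f(n)$ as $m\to\infty$ for every $n$; (ii) $\kappa_n^t(f_m)\to\kappa_n^t(f)$ as $m\to\infty$ for every $n\ge1$.
   Context: $\mathbb{N}=\{0,1,2,\dots\}$. $HR$ is the set of all maps $f:\mathbb{N}\to R$, and $\mathcal{U}(HR)=\{f\in HR:f(0)=1\}$. $(t)_{\underline{n}}=t(t-1)\cdots(t-n+1)$ for $n\ge1$. The cumulants $\kappa_n^t(f)\in R$ of $f\in\mathcal{U}(HR)$ are defined by the formal power series identity $$\sum_{n\ge1}\kappa_n^t(f)z^n=-\frac zt\frac d{dz}\log\left(1+\sum_{n\ge1}\frac{t^n}{(t)_{\underline{n}}}f(n)z^n\right),$$ with the formal logarithm. *)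

theory Defs
  imports Complex_Main "HOL-Computational_Algebra.Formal_Power_Series"
begin

(* U(HR), where the ring R is the type 'a *)
definition UHR :: "(nat \<Rightarrow> 'a::comm_ring_1) set" where
  "UHR = {f. f 0 = 1}"

(* The Omega of R: elements of R that are not nonnegative integers; \<nat> is the image of nat in 'a. *)
definition Omega :: "'a::comm_ring_1 set" where
  "Omega = - \<nat>"

definition falling_fact :: "'a::comm_ring_1 \<Rightarrow> nat \<Rightarrow> 'a" where
  "falling_fact t n = (\<Prod>i<n. t - of_nat i)"

(* fps_ln 1 is the series of log (1 + X). The definition is meaningful only for
   constant coefficient 1. *)
definition fps_log :: "'a::field_char_0 fps \<Rightarrow> 'a fps" where
  "fps_log F = fps_ln 1 oo (F - 1)"

definition cumulant_base :: "'a::field_char_0 \<Rightarrow> (nat \<Rightarrow> 'a) \<Rightarrow> 'a fps" where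
  "cumulant_base t f =
     1 + Abs_fps (\<lambda>n. if n \<ge> 1 then t ^ n / falling_fact t n * f n else 0)"

definition cumulant_series :: "'a::field_char_0 \<Rightarrow> (nat \<Rightarrow> 'a) \<Rightarrow> 'a fps" where
  "cumulant_series t f =
     - (fps_const (1 / t) * fps_X * fps_deriv (fps_log (cumulant_base t f)))"

(* Only n \<ge> 1 is relevant: the series has constant coefficient 0. *)
definition cumulant :: "'a::field_char_0 \<Rightarrow> nat \<Rightarrow> (nat \<Rightarrow> 'a) \<Rightarrow> 'a" where
  "cumulant t n f = fps_nth (cumulant_series t f) n"

end

(* With G the series inside the logarithm and K the cumulant series, the logarithmic derivative
   gives K * G = - (z / t) * G'. As G has constant coefficient 1 and K has constant coefficient 0,
   comparing coefficients expresses each cumulant as a polynomial in the coefficients of G of at most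
   the same index, and vice versa. *)
theory Submission
  imports Defs
begin

lemma falling_fact_nonzero:
  fixes t :: "'a::idom"
  assumes "t \<in> Omega"
  shows "falling_fact t n \<noteq> 0"
  using assms by (auto simp: Omega_def falling_fact_def)

text \<open>Chain rule: the derivative of log(1 + X) is \<open>inverse (1 + fps_X)\<close>. Since
  \<open>F - 1\<close> has constant coefficient 0, substituting it is compatible with inverses and
  yields \<open>inverse F\<close>.\<close>

lemma fps_deriv_fps_log:
  fixes F :: "'a::field_char_0 fps"
  assumes "fps_nth F 0 = 1"
  shows "fps_deriv (fps_log F) = inverse F * fps_deriv F"
proof -
  have F0: "fps_nth (F - 1) 0 = 0"
    using assms by simp
  have "fps_deriv (fps_ln 1 :: 'a fps) = inverse (1 + fps_X)"
    by (simp add: fps_ln_deriv fps_divide_def)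
  moreover have "inverse (1 + fps_X) oo (F - 1) = inverse F"
    using F0 by (simp add: fps_inverse_compose fps_compose_add_distrib)
  ultimately show ?thesis
    using F0 by (simp add: fps_log_def fps_compose_deriv)
qed

lemma cumulant_base_nth:
  "fps_nth (cumulant_base t f) n = (if n = 0 then 1 else t ^ n / falling_fact t n * f n)"
  by (simp add: cumulant_base_def)

lemma cumulant_0: "cumulant t 0 f = 0"
  by (simp add: cumulant_def cumulant_series_def mult.assoc)

lemma cumulant_series_mult_base:
  "cumulant_series t f * cumulant_base t f =
     - (fps_const (1 / t) * fps_X * fps_deriv (cumulant_base t f))"
  by (simp add: cumulant_series_def fps_deriv_fps_log cumulant_base_nth inverse_mult_eq_1' mult_ac)

lemma cumulant_convolution:
  assumes "n \<ge> 1"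
  shows "(\<Sum>i=0..n. cumulant t i f * fps_nth (cumulant_base t f) (n - i)) =
    - (of_nat n / t * fps_nth (cumulant_base t f) n)"
proof -
  from assms obtain k where n: "n = Suc k"
    by (cases n) auto
  have "(\<Sum>i=0..n. cumulant t i f * fps_nth (cumulant_base t f) (n - i)) =
      fps_nth (cumulant_series t f * cumulant_base t f) n"
    by (simp add: fps_mult_nth cumulant_def)
  also have "\<dots> = - (of_nat n / t * fps_nth (cumulant_base t f) n)"
    unfolding cumulant_series_mult_base by (simp add: n mult.assoc)
  finally show ?thesis .
qed

lemma cumulant_rec:
  assumes "n \<ge> 1"
  shows "cumulant t n f = - (of_nat n / t * fps_nth (cumulant_base t f) n) -
    (\<Sum>i<n. cumulant t i f * fps_nth (cumulant_base t f) (n - i))"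
  using cumulant_convolution[OF assms, of t f]
  \<comment> \<open>The summand i = n carries the constant coefficient 1 of the base, so
    \<open>cumulant t n f\<close> splits off without division.\<close>
  by (simp add: atLeast0AtMost lessThan_Suc_atMost[symmetric] cumulant_base_nth algebra_simps)

text \<open>Here the convolution is solved for the base: its coefficient of index n meets
  \<open>cumulant t 0 f\<close>, which is 0, so the sum involves only smaller indices, and
  \<open>of_nat n / t\<close> can be cancelled.\<close>

lemma cumulant_base_rec:
  assumes "t \<noteq> 0" "n \<ge> 1"
  shows "fps_nth (cumulant_base t f) n =
    - (t / of_nat n * (\<Sum>i<n. cumulant t (n - i) f * fps_nth (cumulant_base t f) i))"
proof -
  have "(\<Sum>i=0..n. cumulant t i f * fps_nth (cumulant_base t f) (n - i)) =
      (\<Sum>i=0..n. cumulant t (n - i) f * fps_nth (cumulant_base t f) i)"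
    by (subst sum.atLeastAtMost_rev) simp
  also have "\<dots> = (\<Sum>i<n. cumulant t (n - i) f * fps_nth (cumulant_base t f) i)"
    by (simp add: atLeast0AtMost lessThan_Suc_atMost[symmetric] cumulant_0)
  finally have "- (of_nat n / t * fps_nth (cumulant_base t f) n) =
      (\<Sum>i<n. cumulant t (n - i) f * fps_nth (cumulant_base t f) i)"
    using cumulant_convolution[OF assms(2), of t f] by simp
  \<comment> \<open>Oriented this way, the equation rewrites the sum in the goal.\<close>
  from this[symmetric] show ?thesis
    using assms by simp
qed

text \<open>For n \<ge> 1 the two sequences differ by a fixed nonzero factor. For n = 0 both are
  constant, by membership in \<open>UHR\<close>.\<close>

lemma tendsto_cumulant_base_iff:
  fixes f :: "nat \<Rightarrow> 'a::real_normed_field"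
  assumes "t \<in> Omega" "\<And>m. F m \<in> UHR" "f \<in> UHR"
  shows "(\<lambda>m. fps_nth (cumulant_base t (F m)) n) \<longlonglongrightarrow> fps_nth (cumulant_base t f) n
    \<longleftrightarrow> (\<lambda>m. F m n) \<longlonglongrightarrow> f n"
proof (cases "n = 0")
  case True
  then show ?thesis
    using assms(2,3) by (simp add: cumulant_base_nth UHR_def)
next
  case False
  have "t \<noteq> 0"
    using assms(1) by (auto simp: Omega_def)
  then have "t ^ n / falling_fact t n \<noteq> 0"
    using falling_fact_nonzero[OF assms(1)] by simp
  then show ?thesis
    \<comment> \<open>Without the deletion, simp would merge the quotient with the sequence and hide
      the constant left factor.\<close>
    using False by (simp add: cumulant_base_nth tendsto_mult_left_iff del: times_divide_eq_left)
qed

text \<open>Stated over \<open>real_normed_field\<close> to cover the real and complex cases at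
  once.\<close>

lemma tendsto_cumulant_iff:
  fixes f :: "nat \<Rightarrow> 'a::real_normed_field"
  assumes t: "t \<in> Omega" and F: "\<And>m. F m \<in> UHR" and f: "f \<in> UHR"
  shows "(\<forall>n. (\<lambda>m. F m n) \<longlonglongrightarrow> f n) \<longleftrightarrow>
    (\<forall>n\<ge>1. (\<lambda>m. cumulant t n (F m)) \<longlonglongrightarrow> cumulant t n f)"
proof -
  have t0: "t \<noteq> 0"
    using t by (auto simp: Omega_def)
  have "(\<forall>n. (\<lambda>m. fps_nth (cumulant_base t (F m)) n) \<longlonglongrightarrow> fps_nth (cumulant_base t f) n)
    \<longleftrightarrow> (\<forall>n\<ge>1. (\<lambda>m. cumulant t n (F m)) \<longlonglongrightarrow> cumulant t n f)"
    (is "(\<forall>n. ?G n) \<longleftrightarrow> (\<forall>n\<ge>1. ?K n)")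
  proof safe
    fix n :: nat
    assume G: "\<forall>n. ?G n"
    show "?K n"
    \<comment> \<open>The induction includes n = 0 because the sum in \<open>cumulant_rec\<close>
      starts at i = 0.\<close>
    proof (induction n rule: less_induct)
      case (less n)
      show ?case
      proof (cases "n = 0")
        case True
        then show ?thesis
          by (simp add: cumulant_0)
      next
        case False
        then have n: "n \<ge> 1"
          by simp
        show ?thesis
          unfolding cumulant_rec[OF n] using less G by (intro tendsto_intros) auto
      qed
    qed
  next
    fix n :: nat
    assume K: "\<forall>n\<ge>1. ?K n"
    show "?G n"
    proof (induction n rule: less_induct)
      case (less n)
      show ?case
      proof (cases "n = 0")
        case True
        then show ?thesis
          by (simp add: cumulant_base_nth)
      next
        case False
        then have n: "n \<ge> 1"
          by simp
        show ?thesis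
          \<comment> \<open>For i < n the index n - i is at least 1, so \<open>K\<close> applies to
            the cumulants and the induction hypothesis to the base coefficients.\<close>
          unfolding cumulant_base_rec[OF t0 n] using less K by (intro tendsto_intros) auto
      qed
    qed
  qed
  then show ?thesis
    by (simp only: tendsto_cumulant_base_iff[OF t F f])
qed

theorem lemma3p8:
  shows
    "(\<forall>t \<in> (Omega :: real set). \<forall>F :: nat \<Rightarrow> nat \<Rightarrow> real. \<forall>f :: nat \<Rightarrow> real.
        (\<forall>m. F m \<in> UHR) \<longrightarrow> f \<in> UHR \<longrightarrow>
        ((\<forall>n. (\<lambda>m. F m n) \<longlonglongrightarrow> f n) \<longleftrightarrow>
         (\<forall>n\<ge>1. (\<lambda>m. cumulant t n (F m)) \<longlonglongrightarrow> cumulant t n f))) \<and>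
     (\<forall>t \<in> (Omega :: complex set). \<forall>F :: nat \<Rightarrow> nat \<Rightarrow> complex. \<forall>f :: nat \<Rightarrow> complex.
        (\<forall>m. F m \<in> UHR) \<longrightarrow> f \<in> UHR \<longrightarrow>
        ((\<forall>n. (\<lambda>m. F m n) \<longlonglongrightarrow> f n) \<longleftrightarrow>
         (\<forall>n\<ge>1. (\<lambda>m. cumulant t n (F m)) \<longlonglongrightarrow> cumulant t n f)))"
  by (intro conjI ballI allI impI tendsto_cumulant_iff) auto

end
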